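(* Let $d\in\{2,3\}$, let $\tau\in\mathbb{R}$, and let $H_{\mathcal{A}}$ be a Hermite subdivision scheme of order $d$ with finitely supported matrix mask $\mathcal{A}=\{A_l\in\mathbb{R}^{d\times d},\ l\in\mathbb{Z}\}$, symbol $\mathbf{A}(z)=\sum_{l\in\mathbb{Z}}A_lz^l$, and parametrization $\tau$. Then $H_{\mathcal{A}}$ reproduces constants if and only if $$\mathbf{A}(-1)\mathbf{e}_{1,d}=\mathbf{0}_d,\qquad \mathbf{A}(1)\mathbf{e}_{1,d}=2\mathbf{e}_{1,d}.$$ Moreover, for every integer $m\geq 1$, $H_{\mathcal{A}}$ reproduces polynomials up to degree $m$ if and only if it reproduces constants and, for all $k=1,\dots,m$, $$\mathbf{A}^{(k)}(-1)\mathbf{e}_{1,d}+\sum_{s=2}^{d}\Big(\sum_{\ell=s-1}^{k}\alpha^{s-1}_{k,\ell}\,\mathbf{A}^{(k-\ell)}(-1)\mathbf{e}_{s,d}\Big)=\mathbf{0}_d,$$ $$\mathbf{A}^{(k)}(1)\mathbf{e}_{1,d}+\sum_{s=2}^{d}\Big(\sum_{\ell=s-1}^{k}(-1)^{\ell}\alpha^{s-1}_{k,\ell}\,\mathbf{A}^{(k-\ell)}(1)\mathbf{e}_{s,d}\Big)=\mathbf{q}_{d,k},$$ where sums whose lower limit exceeds their upper limit are zero, and $$\mathbf{q}_{2,k}=\begin{bmatrix}2q_{k,2\tau}(-\frac{\tau}{2})\\ \tilde q_{k,2\tau}(-\frac{\tau}{2})\end{bmatrix},\qquad \mathbf{q}_{3,k}=\begin{bmatrix}2q_{k,2\tau}(-\frac{\tau}{2})\\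 \tilde q_{k,2\tau}(-\frac{\tau}{2})\\ \frac12\hat q_{k,2\tau}(-\frac{\tau}{2})\end{bmatrix}.$$
   Context: Hermite subdivision scheme. Given a finitely supported matrix mask $\mathcal{A}=\{A_l\in\mathbb{R}^{d\times d},\ l\in\mathbb{Z}\}$, the Hermite subdivision scheme $H_{\mathcal{A}}$ of order $d$ produces from an initial sequence $\mathbf{f}_0:\mathbb{Z}\to\mathbb{R}^d$ the sequences $\mathbf{f}_n:\mathbb{Z}\to\mathbb{R}^d$ given by $$\mathbf{D}^{n+1}\mathbf{f}_{n+1}(i)=\sum_{j\in\mathbb{Z}}A_{i-2j}\mathbf{D}^n\mathbf{f}_n(j),\qquad i\in\mathbb{Z},\ n\geq 0,$$ with $\mathbf{D}=\mathrm{diag}(1,\frac12,\dots,\frac1{2^{d-1}})$. The parametrization $\tau\in\mathbb{R}$ of the scheme means that the vector $\mathbf{f}_n(i)$ is attached to the parameter value $(i+\tau)/2^n$. Reproduction. $H_{\mathcal{A}}$ with parametrization $\tau$ reproduces a (sufficiently smooth) function $g:\mathbb{R}\to\mathbb{R}$ if, for the initial data $\mathbf{f}_0(j)=[g(j+\tau),g'(j+\tau),\dots,g^{(d-1)}(j+\tau)]^T$, $j\in\mathbb{Z}$, one has $\mathbf{f}_n(j)=[g((j+\tau)/2^n),g'((j+\tau)/2^n),\dots,g^{(d-1)}((j+\tau)/2^n)]^T$ for all $n\in\mathbb{N}$, $j\in\mathbb{Z}$. It reproduces constants if it reproduces all constant functions, and reproduces polynomials up to degree $m$ if it reproduces every polynomial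 of degree at most $m$. Notation. $\mathbf{e}_{s,d}$ is the $s$-th canonical vector of $\mathbb{R}^d$, $\mathbf{0}_d$ the zero vector; $\mathbf{A}^{(k)}$ is the $k$-th derivative of the matrix Laurent polynomial $\mathbf{A}$, with $\mathbf{A}^{(0)}=\mathbf{A}$. Polynomials and coefficients. For $k\ge 0$ let $q_0(x)=1$, $q_k(x)=\prod_{r=0}^{k-1}(2x-r)$ for $k>0$, and define $\gamma_n^k\in\mathbb{R}$ by $q_k(-x)=\sum_{n=0}^k\gamma_n^kx^n$. For $c\in\mathbb{R}$ let $q_{k,c}(x)=q_k(x+\frac c2)$. For $k\geq1$ the numbers $\alpha^1_{k,\ell}$, $\ell=1,\dots,k$, are defined recursively by $\alpha^1_{k,1}=2k$ and $$\alpha^1_{k,k-n+1}=(-1)^k2^{-n+1}\Big(n\gamma_n^k-\sum_{j=1}^{k-n}(-1)^j\alpha^1_{k,j}\gamma_{n-1}^{k-j}\Big),\quad n=k-1,\dots,1.$$ For $k\geq 2$ the numbers $\alpha^2_{k,\ell}$, $\ell=2,\dots,k$, are defined recursively by $\alpha^2_{k,2}=4k(k-1)$ and $$\alpha^2_{k,k-n+2}=(-1)^k2^{-n+2}\Big(n(n-1)\gamma_n^k-\sum_{j=2}^{k-n+1}(-1)^j\alpha^2_{k,j}\gamma_{n-2}^{k-j}\Big),\quad n=k-1,\dots,2.$$ For $c\in\mathbb{R}$ set $\tilde q_{0,c}=0$, $\tilde q_{k,c}(x)=\sum_{n=1}^k(-1)^n\alpha^1_{k,n}q_{k-n,c}(x)$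 for $k\ge1$; and $\hat q_{0,c}=\hat q_{1,c}=0$, $\hat q_{k,c}(x)=\sum_{n=2}^k(-1)^n\alpha^2_{k,n}q_{k-n,c}(x)$ for $k\geq2$. *)

theory Defs
  imports "HOL-Analysis.Analysis" "HOL-Computational_Algebra.Polynomial"
begin

section \<open>Coordinates of \<open>\<real>\<^sup>d\<close>\<close>

text \<open>
  The dimension \<open>d\<close> is \<open>CARD('d)\<close> for a finite, linearly ordered index type \<open>'d\<close>
  (for example the numeral types \<open>2\<close> and \<open>3\<close>). The order is needed because the scheme treats the
  coordinates differently; \<open>idx\<close> numbers them \<open>1, \<dots>, d\<close> increasingly.
\<close>

definition idx :: "'d::{finite,linorder} \<Rightarrow> nat" where
  "idx i = card {..i}"

lemma idx_strict_mono: "strict_mono (idx :: 'd::{finite,linorder} \<Rightarrow> nat)"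
  unfolding strict_mono_def idx_def by (auto intro!: psubset_card_mono)

lemma idx_bij_betw: "bij_betw (idx :: 'd::{finite,linorder} \<Rightarrow> nat) UNIV {1..CARD('d)}"
proof -
  have inj: "inj (idx :: 'd \<Rightarrow> nat)"
    using idx_strict_mono by (rule strict_mono_imp_inj_on)
  have sub: "range (idx :: 'd \<Rightarrow> nat) \<subseteq> {1..CARD('d)}"
  proof
    fix n assume "n \<in> range (idx :: 'd \<Rightarrow> nat)"
    then obtain i :: 'd where n: "n = card {..i}" by (auto simp: idx_def)
    have "0 < card {..i}" by (auto simp: card_gt_0_iff)
    moreover have "card {..i} \<le> CARD('d)" by (rule card_mono) auto
    ultimately show "n \<in> {1..CARD('d)}" unfolding n atLeastAtMost_iff by linarith
  qed
  have "card (range (idx :: 'd \<Rightarrow> nat)) = card {1..CARD('d)}"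
    using inj by (simp add: card_image)
  with sub have "range (idx :: 'd \<Rightarrow> nat) = {1..CARD('d)}"
    by (intro card_subset_eq) auto
  with inj show ?thesis by (auto simp: bij_betw_def)
qed

definition canonical_vec :: "nat \<Rightarrow> (real, 'd::{finite,linorder}) vec" where
  "canonical_vec s = (\<chi> i. if idx i = s then 1 else 0)"

lemma canonical_vec_idx: "canonical_vec (idx i) = axis i 1"
proof -
  have "idx j = idx i \<longleftrightarrow> j = i" for j
    using strict_mono_eq[OF idx_strict_mono] .
  then show ?thesis by (simp add: canonical_vec_def axis_def vec_eq_iff)
qed


section \<open>Hermite subdivision schemes and reproduction\<close>

type_synonym 'd mask = "int \<Rightarrow> ((real, 'd) vec, 'd) vec"

definition hermite_D :: "((real, 'd::{finite,linorder}) vec, 'd) vec" where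
  "hermite_D = (\<chi> i j. if i = j then 1 / 2 ^ (idx i - 1) else 0)"

text \<open>The matrix power; the overloaded operations on \<open>vec\<close> are componentwise.\<close>

definition hermite_D_pow :: "nat \<Rightarrow> ((real, 'd::{finite,linorder}) vec, 'd) vec" where
  "hermite_D_pow n = (((**) hermite_D) ^^ n) (mat 1)"

text \<open>The sum over \<open>j \<in> \<int>\<close> is restricted to its finitely many nonzero coefficients.\<close>

definition hermite_scheme :: "'d::{finite,linorder} mask \<Rightarrow> (nat \<Rightarrow> int \<Rightarrow> (real, 'd) vec) \<Rightarrow> bool" where
  "hermite_scheme A f \<longleftrightarrow>
     (\<forall>n i. hermite_D_pow (n + 1) *v f (n + 1) i =
        (\<Sum>j | A (i - 2 * j) \<noteq> 0. A (i - 2 * j) *v (hermite_D_pow n *v f n j)))"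

lemma hermite_D_pow_mult: "hermite_D_pow n *v v = (\<chi> i. v $ i / 2 ^ (n * (idx i - 1)))"
proof (induction n)
  case 0
  show ?case by (simp add: hermite_D_pow_def vec_eq_iff)
next
  case (Suc n)
  have D: "hermite_D *v w = (\<chi> i. w $ i / 2 ^ (idx i - 1))" for w :: "(real, 'a) vec"
    by (simp add: hermite_D_def matrix_vector_mult_def vec_eq_iff if_distrib[of "\<lambda>x. x * _"] cong: if_cong)
  have "hermite_D_pow (Suc n) *v v = hermite_D *v (hermite_D_pow n *v v)"
    by (simp add: hermite_D_pow_def matrix_vector_mul_assoc)
  also have "\<dots> = (\<chi> i. v $ i / 2 ^ (Suc n * (idx i - 1)))"
    by (simp add: Suc D vec_eq_iff power_add mult.commute)
  finally show ?case .
qed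

lemma hermite_scheme_ex1: "\<exists>!f. hermite_scheme A f \<and> f 0 = f0"
proof -
  define S where "S n g i = (\<Sum>j | A (i - 2 * j) \<noteq> 0. A (i - 2 * j) *v (hermite_D_pow n *v g j))"
    for n i and g :: "int \<Rightarrow> (real, 'a) vec"
  define step where "step n g = (\<lambda>i. (\<chi> r. 2 ^ ((n + 1) * (idx r - 1)) * S n g i $ r))" for n g
  have scheme: "hermite_scheme A f \<longleftrightarrow> (\<forall>n. f (Suc n) = step n (f n))" for f
  proof -
    have eq: "v / 2 ^ m = w \<longleftrightarrow> v = 2 ^ m * w" for v w :: real and m :: nat
      by (auto simp: field_simps)
    have "(hermite_D_pow (n + 1) *v f (n + 1) i = S n (f n) i) \<longleftrightarrow> f (Suc n) i = step n (f n) i" for n i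
      by (simp only: hermite_D_pow_mult vec_eq_iff vec_lambda_beta eq step_def Suc_eq_plus1)
    then show ?thesis unfolding hermite_scheme_def S_def[symmetric] by (simp add: fun_eq_iff)
  qed
  define F where "F = rec_nat f0 step"
  show ?thesis
  proof (rule ex1I[of _ F])
    show "hermite_scheme A F \<and> F 0 = f0" by (simp add: scheme F_def)
  next
    fix f assume f: "hermite_scheme A f \<and> f 0 = f0"
    have "f n = F n" for n using f by (induction n) (simp_all add: scheme F_def)
    then show "f = F" by auto
  qed
qed

definition jet :: "(real \<Rightarrow> real) \<Rightarrow> real \<Rightarrow> (real, 'd::{finite,linorder}) vec" where
  "jet g x = (\<chi> i. (deriv ^^ (idx i - 1)) g x)"

definition reproduces :: "'d::{finite,linorder} mask \<Rightarrow> real \<Rightarrow> (real \<Rightarrow> real) \<Rightarrow> bool" where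
  "reproduces A \<tau> g \<longleftrightarrow>
     (\<forall>f. hermite_scheme A f \<and> (\<forall>j. f 0 j = jet g (of_int j + \<tau>)) \<longrightarrow>
        (\<forall>n j. f n j = jet g ((of_int j + \<tau>) / 2 ^ n)))"

definition reproduces_constants :: "'d::{finite,linorder} mask \<Rightarrow> real \<Rightarrow> bool" where
  "reproduces_constants A \<tau> \<longleftrightarrow> (\<forall>c. reproduces A \<tau> (\<lambda>_. c))"

definition reproduces_polynomials :: "'d::{finite,linorder} mask \<Rightarrow> real \<Rightarrow> nat \<Rightarrow> bool" where
  "reproduces_polynomials A \<tau> m \<longleftrightarrow> (\<forall>p :: real poly. degree p \<le> m \<longrightarrow> reproduces A \<tau> (poly p))"


section \<open>The symbol\<close>

text \<open>The symbol is only needed near \<open>1\<close> and \<open>-1\<close>, so a real variable suffices.\<close>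

definition mask_symbol :: "'d::{finite,linorder} mask \<Rightarrow> real \<Rightarrow> ((real, 'd) vec, 'd) vec" where
  "mask_symbol A z = (\<Sum>l | A l \<noteq> 0. (z powi l) *\<^sub>R A l)"

definition mask_symbol_deriv :: "'d::{finite,linorder} mask \<Rightarrow> nat \<Rightarrow> real \<Rightarrow> ((real, 'd) vec, 'd) vec" where
  "mask_symbol_deriv A k = ((\<lambda>F z. vector_derivative F (at z)) ^^ k) (mask_symbol A)"


section \<open>Polynomials and coefficients\<close>

definition q_poly :: "nat \<Rightarrow> real poly" where
  "q_poly k = (\<Prod>r<k. [:- of_nat r, 2:])"

lemma poly_q_poly: "poly (q_poly k) x = (\<Prod>r<k. 2 * x - of_nat r)"
  by (simp add: q_poly_def poly_prod algebra_simps)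

definition q_coeff :: "nat \<Rightarrow> nat \<Rightarrow> real" where
  "q_coeff k n = coeff (pcompose (q_poly k) [:0, -1:]) n"

lemma q_coeff_expansion: "poly (q_poly k) (- x) = (\<Sum>n\<le>k. q_coeff k n * x ^ n)"
proof -
  have "degree (q_poly k) \<le> (\<Sum>r<k. degree [:- of_nat r, 2 :: real:])"
    unfolding q_poly_def by (rule order.trans[OF degree_prod_sum_le]) simp_all
  then have "degree (pcompose (q_poly k) [:0, -1:]) \<le> k"
    by (simp add: degree_pcompose)
  then have "poly (pcompose (q_poly k) [:0, -1:]) x = (\<Sum>n\<le>k. q_coeff k n * x ^ n)"
    unfolding q_coeff_def poly_altdef by (intro sum.mono_neutral_left) (auto simp: coeff_eq_0)
  then show ?thesis by (simp add: poly_pcompose)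
qed

definition q_shift :: "nat \<Rightarrow> real \<Rightarrow> real \<Rightarrow> real" where
  "q_shift k c x = poly (q_poly k) (x + c / 2)"

text \<open>
  The recursions for \<open>\<alpha>\<^sup>1\<close> and \<open>\<alpha>\<^sup>2\<close>, rewritten with \<open>\<ell>\<close> as the
  recursion variable: \<open>n = k - \<ell> + 1\<close> and \<open>n = k - \<ell> + 2\<close>, respectively. The value \<open>0\<close>
  outside of the ranges \<open>1 \<le> \<ell> \<le> k\<close> and \<open>2 \<le> \<ell> \<le> k\<close> is immaterial.
\<close>

function alpha1 :: "nat \<Rightarrow> nat \<Rightarrow> real" where
  "alpha1 k l =
     (if l < 1 \<or> k < l then 0
      else if l = 1 then 2 * of_nat k
      else (let n = k - l + 1 in
        (-1) ^ k * (1 / 2 ^ (n - 1)) *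
          (of_nat n * q_coeff k n - (\<Sum>j\<in>{1..<l}. (-1) ^ j * alpha1 k j * q_coeff (k - j) (n - 1)))))"
  by auto
termination by (relation "Wellfounded.measure snd") auto

function alpha2 :: "nat \<Rightarrow> nat \<Rightarrow> real" where
  "alpha2 k l =
     (if l < 2 \<or> k < l then 0
      else if l = 2 then 4 * of_nat k * (of_nat k - 1)
      else (let n = k - l + 2 in
        (-1) ^ k * (1 / 2 ^ (n - 2)) *
          (of_nat n * (of_nat n - 1) * q_coeff k n
            - (\<Sum>j\<in>{2..<l}. (-1) ^ j * alpha2 k j * q_coeff (k - j) (n - 2)))))"
  by auto
termination by (relation "Wellfounded.measure snd") auto

declare alpha1.simps [simp del] alpha2.simps [simp del]

lemma alpha1_first: "k \<ge> 1 \<Longrightarrow> alpha1 k 1 = 2 * of_nat k"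
  by (subst alpha1.simps) simp

lemma alpha1_rec:
  assumes "1 \<le> n" "n \<le> k - 1"
  shows "alpha1 k (k - n + 1) = (-1) ^ k * 2 powi (- int n + 1) *
    (of_nat n * q_coeff k n - (\<Sum>j = 1..k - n. (-1) ^ j * alpha1 k j * q_coeff (k - j) (n - 1)))"
proof -
  have range: "{1..<k - n + 1} = {1..k - n}" by auto
  have "- int n + 1 = - int (n - 1)" using assms by simp
  then have pow: "(2 :: real) powi (- int n + 1) = 1 / 2 ^ (n - 1)"
    by (simp only: power_int_minus power_int_of_nat) (simp add: field_simps)
  have n: "k - (k - n + 1) + 1 = n" using assms by simp
  have cases: "\<not> k - n + 1 < 1" "\<not> k < k - n + 1" "k - n + 1 \<noteq> 1" using assms by auto
  show ?thesis
    by (subst alpha1.simps) (simp only: Let_def range pow n cases simp_thms if_False)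
qed

lemma alpha2_first: "k \<ge> 2 \<Longrightarrow> alpha2 k 2 = 4 * of_nat k * (of_nat k - 1)"
  by (subst alpha2.simps) simp

lemma alpha2_rec:
  assumes "2 \<le> n" "n \<le> k - 1"
  shows "alpha2 k (k - n + 2) = (-1) ^ k * 2 powi (- int n + 2) *
    (of_nat n * (of_nat n - 1) * q_coeff k n
      - (\<Sum>j = 2..k - n + 1. (-1) ^ j * alpha2 k j * q_coeff (k - j) (n - 2)))"
proof -
  have range: "{2..<k - n + 2} = {2..k - n + 1}" by auto
  have "- int n + 2 = - int (n - 2)" using assms by simp
  then have pow: "(2 :: real) powi (- int n + 2) = 1 / 2 ^ (n - 2)"
    by (simp only: power_int_minus power_int_of_nat) (simp add: field_simps)
  have n: "k - (k - n + 2) + 2 = n" using assms by simp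
  have cases: "\<not> k - n + 2 < 2" "\<not> k < k - n + 2" "k - n + 2 \<noteq> 2" using assms by auto
  show ?thesis
    by (subst alpha2.simps) (simp only: Let_def range pow n cases simp_thms if_False)
qed

text \<open>The superscripted family \<open>\<alpha>\<^sup>s\<close>, where only \<open>s = 1\<close> and \<open>s = 2\<close> occur.\<close>

definition alpha :: "nat \<Rightarrow> nat \<Rightarrow> nat \<Rightarrow> real" where
  "alpha s = (if s = 1 then alpha1 else alpha2)"

definition q_tilde :: "nat \<Rightarrow> real \<Rightarrow> real \<Rightarrow> real" where
  "q_tilde k c x = (\<Sum>n = 1..k. (-1) ^ n * alpha1 k n * q_shift (k - n) c x)"

definition q_hat :: "nat \<Rightarrow> real \<Rightarrow> real \<Rightarrow> real" where
  "q_hat k c x = (\<Sum>n = 2..k. (-1) ^ n * alpha2 k n * q_shift (k - n) c x)"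

text \<open>
  The right-hand side for \<open>d = 2\<close> and \<open>d = 3\<close> at once; there is no third coordinate if \<open>d = 2\<close>.
\<close>

definition q_vec :: "real \<Rightarrow> nat \<Rightarrow> (real, 'd::{finite,linorder}) vec" where
  "q_vec \<tau> k = (\<chi> i.
     if idx i = 1 then 2 * q_shift k (2 * \<tau>) (- \<tau> / 2)
     else if idx i = 2 then q_tilde k (2 * \<tau>) (- \<tau> / 2)
     else 1 / 2 * q_hat k (2 * \<tau>) (- \<tau> / 2))"

end

(*
  Reproduction of a polynomial h means that one step of the scheme maps the samples of h to the
  samples of h at the refined parameters. Replacing h by its reflection p(x) = h(i/2 + tau - x)
  turns the rule at i into an equation for p that depends on i only through its parity.
  It is linear in p, so it suffices to check it on the basis q_0, ..., q_m of the polynomials of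
  degree at most m. Since the k-th derivative of z^l is q_k(l/2) z^(l-k), and since the numbers
  alpha^s are the coefficients of the s-th derivative of q_k in this basis, the sum and the
  difference of the two parity equations for q_k are the conditions at 1 and -1.
*)
theory Submission
  imports Defs
begin

section \<open>Derivatives of polynomials\<close>

lemma funpow_deriv_poly: "(deriv ^^ n) (poly p) = poly ((pderiv ^^ n) p)" for p :: "real poly"
proof (induction n)
  case (Suc n)
  have "deriv (poly q) = poly (pderiv q)" for q :: "real poly"
    by (rule ext) (rule DERIV_imp_deriv[OF poly_DERIV])
  then show ?case by (simp add: Suc)
qed simp

lemma funpow_pderiv_pcompose_linear:
  "(pderiv ^^ n) (pcompose p [:a, b:]) = smult (b ^ n) (pcompose ((pderiv ^^ n) p) [:a, b:])"
  for p :: "real poly"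
  by (induction n)
    (simp_all add: pderiv_smult pderiv_pcompose pderiv_pCons mult.commute[of _ "[:b:]"] mult.commute)


section \<open>The basis of the polynomials \<open>q\<^sub>k\<close>\<close>

lemma degree_q_poly_le: "degree (q_poly k) \<le> k"
proof -
  have "degree (q_poly k) \<le> (\<Sum>r<k. degree [:- of_nat r, 2 :: real:])"
    unfolding q_poly_def by (rule order.trans[OF degree_prod_sum_le]) simp_all
  then show ?thesis by simp
qed

lemma coeff_q_poly_top: "coeff (q_poly k) k = 2 ^ k"
proof (induction k)
  case (Suc k)
  have "q_poly (Suc k) = [:- of_nat k, 2:] * q_poly k"
    by (simp add: q_poly_def mult.commute)
  then show ?case
    using degree_q_poly_le[of k] by (simp add: Suc coeff_eq_0)
qed (simp add: q_poly_def)

lemma q_coeff_eq: "q_coeff k n = (-1) ^ n * coeff (q_poly k) n"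
  by (simp add: q_coeff_def coeff_pcompose_linear)

lemma q_coeff_top: "q_coeff k k = (-2) ^ k"
  by (simp add: q_coeff_eq coeff_q_poly_top flip: power_mult_distrib)

lemma q_coeff_eq_0: "k < n \<Longrightarrow> q_coeff k n = 0"
  using degree_q_poly_le[of k] by (simp add: q_coeff_eq coeff_eq_0)

text \<open>Each q_k has degree exactly k, with leading coefficient 2^k, so the top coefficient can
  be cleared and the degree lowered.\<close>

lemma poly_in_q_basis:
  assumes "degree p \<le> m"
  obtains c where "p = (\<Sum>k\<le>m. smult (c k) (q_poly k))"
  using assms
proof (induction m arbitrary: p thesis)
  case 0
  then obtain a where "p = [:a:]" by (metis degree_eq_zeroE le_zero_eq)
  then have "p = (\<Sum>k\<le>0. smult a (q_poly k))" by (simp add: q_poly_def)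
  then show ?case by (rule 0)
next
  case (Suc m)
  define a where "a = coeff p (Suc m) / 2 ^ Suc m"
  define r where "r = p - smult a (q_poly (Suc m))"
  have "degree r \<le> m"
  proof (rule degree_le, intro allI impI)
    fix i assume "m < i"
    show "coeff r i = 0"
    proof (cases "i = Suc m")
      case True
      then show ?thesis using coeff_q_poly_top[of "Suc m"] by (simp add: r_def a_def)
    next
      case False
      with \<open>m < i\<close> have "Suc m < i" by simp
      then show ?thesis
        using Suc.prems(2) degree_q_poly_le[of "Suc m"] by (simp add: r_def coeff_eq_0)
    qed
  qed
  then obtain c where c: "r = (\<Sum>k\<le>m. smult (c k) (q_poly k))" using Suc.IH by blast
  have "p = r + smult a (q_poly (Suc m))" by (simp add: r_def)
  also have "\<dots> = (\<Sum>k\<le>Suc m. smult ((c(Suc m := a)) k) (q_poly k))" by (simp add: c)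
  finally show ?case by (rule Suc.prems(1))
qed

text \<open>The premise is the triangular system that the recursions for \<open>\<alpha>\<^sup>1\<close> and \<open>\<alpha>\<^sup>2\<close> solve.\<close>

lemma higher_pderiv_q_poly:
  assumes "\<And>r. r + s \<le> k \<Longrightarrow>
    (\<Sum>j = s..k - r. (-1) ^ j * a j * q_coeff (k - j) r) = pochhammer (1 + real r) s * q_coeff k (r + s)"
  shows "(\<Sum>j = s..k. smult ((-1) ^ j * a j) (q_poly (k - j))) = smult ((-1) ^ s) ((pderiv ^^ s) (q_poly k))"
proof (rule poly_eqI)
  fix r
  have q: "coeff (q_poly i) n = (-1) ^ n * q_coeff i n" for i n
    by (simp add: q_coeff_eq flip: power_mult_distrib mult.assoc)
  \<comment> \<open>The premise covers only \<open>r + s \<le> k\<close> and stops at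
    \<open>k - r\<close>. Later summands vanish because q_(k-j) has degree below r; for
    \<open>r + s > k\<close> both sides are zero.\<close>
  have "(\<Sum>j = s..k. (-1) ^ j * a j * q_coeff (k - j) r) = pochhammer (1 + real r) s * q_coeff k (r + s)"
  proof (cases "r + s \<le> k")
    case True
    have "(\<Sum>j = s..k. (-1) ^ j * a j * q_coeff (k - j) r) = (\<Sum>j = s..k - r. (-1) ^ j * a j * q_coeff (k - j) r)"
      by (rule sum.mono_neutral_right) (auto simp: q_coeff_eq_0)
    then show ?thesis using assms[OF True] by simp
  next
    case False
    then have "(\<Sum>j = s..k. (-1) ^ j * a j * q_coeff (k - j) r) = 0"
      by (intro sum.neutral) (auto simp: q_coeff_eq_0)
    then show ?thesis using False by (simp add: q_coeff_eq_0)
  qed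
  \<comment> \<open>The sign \<open>(-1) ^ r\<close> turns coefficients of q(-x) into those of q(x);
    the Pochhammer factor (r+1)...(r+s) comes from differentiating x^(r+s) s times.\<close>
  then have "(-1) ^ r * (\<Sum>j = s..k. (-1) ^ j * a j * q_coeff (k - j) r)
      = (-1) ^ s * (pochhammer (1 + real r) s * ((-1) ^ (r + s) * q_coeff k (r + s)))"
    by (simp add: power_add)
  then show "coeff (\<Sum>j = s..k. smult ((-1) ^ j * a j) (q_poly (k - j))) r
      = coeff (smult ((-1) ^ s) ((pderiv ^^ s) (q_poly k))) r"
    by (simp add: coeff_sum coeff_higher_pderiv q sum_distrib_left mult_ac)
qed

text \<open>Comparing coefficients at x^r leaves \<open>alpha1 k (k - r)\<close> as the last
  unknown. The recursion with \<open>n = r + 1\<close> is this equation solved for it; the initial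
  value is the case \<open>r = k - 1\<close>, where -2k (-2)^(k-1) = k (-2)^k.\<close>

lemma pderiv_q_poly:
  "(\<Sum>j = 1..k. smult ((-1) ^ j * alpha1 k j) (q_poly (k - j))) = smult ((-1) ^ 1) ((pderiv ^^ 1) (q_poly k))"
proof (rule higher_pderiv_q_poly)
  fix r assume r: "r + 1 \<le> k"
  show "(\<Sum>j = 1..k - r. (-1) ^ j * alpha1 k j * q_coeff (k - j) r)
      = pochhammer (1 + real r) 1 * q_coeff k (r + 1)"
  proof (cases "r + 1 = k")
    case True
    then have k: "k = Suc r" by simp
    show ?thesis
      using alpha1_first[of k] q_coeff_top[of r] q_coeff_top[of k] by (simp add: k algebra_simps)
  next
    case False
    define S where "S = (\<Sum>j = 1..k - (r + 1). (-1) ^ j * alpha1 k j * q_coeff (k - j) r)"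
    have sign: "(-1 :: real) ^ (k - r) = (-1) ^ k * (-1) ^ r"
      using r by (simp add: minus_one_power_iff)
    have sq: "(-1 :: real) ^ n * ((-1) ^ n * x) = x" for n x
      by (simp flip: power_mult_distrib mult.assoc)
    have k: "k - (k - r) = r" using r by auto
    have "alpha1 k (k - r) = (-1) ^ k * (1 / 2 ^ r) * (real (r + 1) * q_coeff k (r + 1) - S)"
      using alpha1_rec[of "r + 1" k] r False
      by (simp add: S_def power_int_minus field_simps Suc_diff_Suc)
    \<comment> \<open>The last summand has the coefficient (-2)^r. Its product with (-1)^(k-r) and
      with the factor (-1)^k / 2^r of the recursion is 1, so \<open>S\<close> cancels.\<close>
    moreover have "(\<Sum>j = 1..k - r. (-1) ^ j * alpha1 k j * q_coeff (k - j) r)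
        = S + (-1) ^ (k - r) * alpha1 k (k - r) * (-2) ^ r"
    proof -
      have "{1..k - r} = insert (k - r) {1..k - (r + 1)}" "k - r \<notin> {1..k - (r + 1)}" using r by auto
      then show ?thesis by (simp add: S_def k q_coeff_top)
    qed
    moreover have "(-2 :: real) ^ r = (-1) ^ r * 2 ^ r"
      by (rule power_minus)
    ultimately show ?thesis
      by (simp add: sign sq mult_ac)
  qed
qed

text \<open>The same elimination one order higher, with \<open>n = r + 2\<close>; the initial value
  solves the equation for \<open>r = k - 2\<close>, since 4k(k-1) (-2)^(k-2) = k(k-1)
  (-2)^k.\<close>

lemma pderiv2_q_poly:
  "(\<Sum>j = 2..k. smult ((-1) ^ j * alpha2 k j) (q_poly (k - j))) = smult ((-1) ^ 2) ((pderiv ^^ 2) (q_poly k))"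
proof (rule higher_pderiv_q_poly)
  fix r assume r: "r + 2 \<le> k"
  have poch: "pochhammer (1 + real r) 2 = real (r + 2) * (real (r + 2) - 1)"
    by (simp add: pochhammer_Suc numeral_2_eq_2)
  show "(\<Sum>j = 2..k - r. (-1) ^ j * alpha2 k j * q_coeff (k - j) r)
      = pochhammer (1 + real r) 2 * q_coeff k (r + 2)"
  proof (cases "r + 2 = k")
    case True
    then have k: "k = Suc (Suc r)" by simp
    have j: "{2..k - r} = {2}" "k - 2 = r" by (auto simp: k)
    show ?thesis
      using alpha2_first[of k] q_coeff_top[of r] q_coeff_top[of k] unfolding poch j by (simp add: k)
  next
    case False
    define S where "S = (\<Sum>j = 2..k - (r + 1). (-1) ^ j * alpha2 k j * q_coeff (k - j) r)"
    have sign: "(-1 :: real) ^ (k - r) = (-1) ^ k * (-1) ^ r"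
      using r by (simp add: minus_one_power_iff)
    have sq: "(-1 :: real) ^ n * ((-1) ^ n * x) = x" for n x
      by (simp flip: power_mult_distrib mult.assoc)
    \<comment> \<open>With \<open>n = r + 2\<close> the recursion sums up to k-n+1 = k-(r+1) and
      determines the entry k-n+2 = k-r.\<close>
    have k: "k - (k - r) = r" "k - (r + 2) + 1 = k - (r + 1)"
      "k - (r + 2) + 2 = k - r" using r by auto
    have "alpha2 k (k - r) = (-1) ^ k * (1 / 2 ^ r) * (real (r + 2) * (real (r + 2) - 1) * q_coeff k (r + 2) - S)"
      using alpha2_rec[of "r + 2" k] r False unfolding k
      by (simp add: S_def power_int_minus field_simps)
    moreover have "(\<Sum>j = 2..k - r. (-1) ^ j * alpha2 k j * q_coeff (k - j) r)
        = S + (-1) ^ (k - r) * alpha2 k (k - r) * (-2) ^ r"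
    proof -
      have "{2..k - r} = insert (k - r) {2..k - (r + 1)}" "k - r \<notin> {2..k - (r + 1)}" using r by auto
      then show ?thesis by (simp add: S_def k(1) q_coeff_top)
    qed
    moreover have "(-2 :: real) ^ r = (-1) ^ r * 2 ^ r"
      by (rule power_minus)
    ultimately show ?thesis
      unfolding poch by (simp add: sign sq mult_ac)
  qed
qed

lemma sum_alpha_q_poly:
  assumes "s \<in> {1, 2}"
  shows "(\<Sum>n = s..k. (-1) ^ n * alpha s k n * poly (q_poly (k - n)) y)
    = (-1) ^ s * poly ((pderiv ^^ s) (q_poly k)) y"
proof -
  have "(\<Sum>j = s..k. smult ((-1) ^ j * alpha s k j) (q_poly (k - j))) = smult ((-1) ^ s) ((pderiv ^^ s) (q_poly k))"
    using assms pderiv_q_poly[of k] pderiv2_q_poly[of k] by (auto simp: alpha_def)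
  from arg_cong[OF this, of "\<lambda>p. poly p y"] show ?thesis by (simp add: poly_sum)
qed


section \<open>Derivatives of the symbol\<close>

text \<open>Differentiating z^(l-k) brings down l - k = 2(l/2) - k, the next factor of
  q_(k+1)(l/2).\<close>

lemma mask_symbol_deriv_eq:
  fixes A :: "'d::{finite,linorder} mask" and z :: real
  assumes "finite {l. A l \<noteq> 0}" "z \<noteq> 0"
  shows "mask_symbol_deriv A k z
    = (\<Sum>l | A l \<noteq> 0. (poly (q_poly k) (of_int l / 2) * z powi (l - int k)) *\<^sub>R A l)"
  using assms(2)
proof (induction k arbitrary: z)
  case 0
  then show ?case by (simp add: mask_symbol_deriv_def mask_symbol_def q_poly_def)
next
  case (Suc k)
  let ?F = "\<lambda>z :: real. \<Sum>l | A l \<noteq> 0. (poly (q_poly k) (of_int l / 2) * z powi (l - int k)) *\<^sub>R A l"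
  let ?D = "\<Sum>l | A l \<noteq> 0. (poly (q_poly (Suc k)) (of_int l / 2) * z powi (l - int (Suc k))) *\<^sub>R A l"
  have q: "poly (q_poly (Suc k)) (of_int l / 2) = poly (q_poly k) (of_int l / 2) * of_int (l - int k)" for l
    by (simp add: poly_q_poly)
  have "(?F has_vector_derivative ?D) (at z)"
  proof (rule has_vector_derivative_sum)
    fix l
    have "((\<lambda>z :: real. z powi (l - int k)) has_field_derivative of_int (l - int k) * z powi (l - int k - 1)) (at z)"
      using Suc.prems DERIV_power_int[OF DERIV_ident, where x = z and n = "l - int k" and s = UNIV] by simp
    then have "((\<lambda>z :: real. poly (q_poly k) (of_int l / 2) * z powi (l - int k)) has_field_derivative
        poly (q_poly k) (of_int l / 2) * (of_int (l - int k) * z powi (l - int k - 1))) (at z)"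
      by (rule DERIV_cmult)
    moreover have "l - int (Suc k) = l - int k - 1" by simp
    ultimately have "((\<lambda>z :: real. poly (q_poly k) (of_int l / 2) * z powi (l - int k)) has_field_derivative
        poly (q_poly (Suc k)) (of_int l / 2) * z powi (l - int (Suc k))) (at z)"
      by (simp only: q mult.assoc)
    from has_vector_derivative_scaleR[OF this has_vector_derivative_const[of "A l"]]
    show "((\<lambda>z :: real. (poly (q_poly k) (of_int l / 2) * z powi (l - int k)) *\<^sub>R A l) has_vector_derivative
        (poly (q_poly (Suc k)) (of_int l / 2) * z powi (l - int (Suc k))) *\<^sub>R A l) (at z)"
      by simp
  qed
  \<comment> \<open>The induction hypothesis holds only at nonzero arguments, hence the passage to
    the open set \<open>- {0}\<close> around \<open>z\<close>.\<close>
  then have "(mask_symbol_deriv A k has_vector_derivative ?D) (at z)"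
    by (rule has_vector_derivative_transform_within_open[of _ _ _ "- {0}"])
      (use Suc in auto)
  then show ?case
    by (simp add: mask_symbol_deriv_def vector_derivative_at)
qed


section \<open>Reproduction as a parity condition\<close>

text \<open>The powers of 1/2 from the chain rule are the diagonal entries of D^n, so level n looks
  like level 0 for a dilated polynomial.\<close>

lemma jet_poly_scale:
  "hermite_D_pow n *v jet (poly p) (x / 2 ^ n) = jet (poly (pcompose p [:0, 1 / 2 ^ n:])) x"
  by (simp add: hermite_D_pow_mult jet_def vec_eq_iff funpow_deriv_poly
      funpow_pderiv_pcompose_linear poly_pcompose power_divide power_mult)

text \<open>This is the jet of x -> p(-x) at the point -y.\<close>

definition reflected_jet :: "real poly \<Rightarrow> real \<Rightarrow> (real, 'd::{finite,linorder}) vec" where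
  "reflected_jet p y = (\<chi> i. (-1) ^ (idx i - 1) * poly ((pderiv ^^ (idx i - 1)) p) y)"

lemma jet_poly_reflect: "jet (poly p) (a - y) = reflected_jet (pcompose p [:a, -1:]) y"
  by (simp add: reflected_jet_def jet_def vec_eq_iff funpow_deriv_poly
      funpow_pderiv_pcompose_linear poly_pcompose flip: power_mult_distrib mult.assoc)

lemma reflected_jet_linear:
  "reflected_jet (\<Sum>k\<in>K. smult (c k) (p k)) y = (\<Sum>k\<in>K. c k *\<^sub>R reflected_jet (p k) y)"
  by (simp add: reflected_jet_def vec_eq_iff higher_pderiv_sum higher_pderiv_smult poly_sum
      sum_distrib_left mult_ac)

lemma reflected_jet_expand:
  "reflected_jet p y = (\<Sum>s = 1..CARD('d).
    ((-1) ^ (s - 1) * poly ((pderiv ^^ (s - 1)) p) y) *\<^sub>R (canonical_vec s :: (real, 'd::{finite,linorder}) vec))"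
proof -
  have "(\<Sum>s = 1..CARD('d). ((-1) ^ (s - 1) * poly ((pderiv ^^ (s - 1)) p) y) *\<^sub>R (canonical_vec s :: (real, 'd) vec))
    = (\<Sum>j\<in>UNIV. ((-1) ^ (idx j - 1) * poly ((pderiv ^^ (idx j - 1)) p) y) *\<^sub>R (canonical_vec (idx (j :: 'd)) :: (real, 'd) vec))"
    by (rule sum.reindex_bij_betw[OF idx_bij_betw, symmetric])
  also have "\<dots> = reflected_jet p y"
    by (simp add: reflected_jet_def vec_eq_iff canonical_vec_idx axis_def if_distrib cong: if_cong)
  finally show ?thesis by simp
qed

text \<open>Initial data determine the sequence uniquely, so it suffices to test the sampled jets
  themselves.\<close>

lemma reproduces_iff: "reproduces A \<tau> g \<longleftrightarrow> hermite_scheme A (\<lambda>n j. jet g ((of_int j + \<tau>) / 2 ^ n))"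
proof -
  let ?J = "\<lambda>n j. jet g ((of_int j + \<tau>) / 2 ^ n)"
  obtain f where f: "hermite_scheme A f" "f 0 = ?J 0"
    and unique: "\<And>h. hermite_scheme A h \<Longrightarrow> h 0 = ?J 0 \<Longrightarrow> h = f"
    using hermite_scheme_ex1[of A "?J 0"] by blast
  show ?thesis
  proof
    assume "reproduces A \<tau> g"
    moreover have "\<forall>j. f 0 j = jet g (of_int j + \<tau>)" using f(2) by simp
    ultimately have "\<forall>n j. f n j = ?J n j" using f(1) unfolding reproduces_def by blast
    then have "f = ?J" by (simp add: fun_eq_iff)
    then show "hermite_scheme A ?J" using f(1) by simp
  next
    assume J: "hermite_scheme A ?J"
    show "reproduces A \<tau> g"
      unfolding reproduces_def
    proof (intro allI impI)
      fix h n j assume h: "hermite_scheme A h \<and> (\<forall>j. h 0 j = jet g (of_int j + \<tau>))"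
      then have "h 0 = ?J 0" by (simp add: fun_eq_iff)
      then have "h = f" using h unique by blast
      moreover have "?J = f" using J unique by blast
      ultimately show "h n j = ?J n j" by metis
    qed
  qed
qed

text \<open>With \<open>l = i - 2 * j\<close>, the sum over j becomes a sum over all l of the parity
  of i. After reflection the sampling points l/2 and \<tau>/2 no longer involve i.\<close>

definition reproduction_defect ::
    "'d::{finite,linorder} mask \<Rightarrow> real \<Rightarrow> int \<Rightarrow> real poly \<Rightarrow> (real, 'd) vec" where
  "reproduction_defect A \<tau> i p =
    (\<Sum>l | A l \<noteq> 0 \<and> even (i - l). A l *v reflected_jet p (of_int l / 2))
      - hermite_D *v reflected_jet p (\<tau> / 2)"

lemma reproduction_defect_linear:
  "reproduction_defect A \<tau> i (\<Sum>k\<in>K. smult (c k) (p k)) = (\<Sum>k\<in>K. c k *\<^sub>R reproduction_defect A \<tau> i (p k))"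
proof -
  have mv: "M *v (\<Sum>k\<in>K. c k *\<^sub>R v k) = (\<Sum>k\<in>K. c k *\<^sub>R (M *v v k))" for M :: "((real, 'a) vec, 'a) vec" and v
    by (simp add: linear_sum linear_scale)
  show ?thesis
    unfolding reproduction_defect_def reflected_jet_linear mv
    by (subst sum.swap) (simp add: scaleR_right_diff_distrib sum_subtractf scaleR_sum_right)
qed

text \<open>With a = i/2 + \<tau>, the points are j + \<tau> = a - (i - 2j)/2 and (i + \<tau>)/2 = a
  - \<tau>/2.\<close>

lemma scheme_step_iff:
  "hermite_D *v jet (poly h) ((of_int i + \<tau>) / 2)
      = (\<Sum>j | A (i - 2 * j) \<noteq> 0. A (i - 2 * j) *v jet (poly h) (of_int j + \<tau>))
    \<longleftrightarrow> reproduction_defect A \<tau> i (pcompose h [:of_int i / 2 + \<tau>, -1:]) = 0"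
proof -
  let ?p = "pcompose h [:of_int i / 2 + \<tau>, -1:]"
  have D: "jet (poly h) ((of_int i + \<tau>) / 2) = reflected_jet ?p (\<tau> / 2)"
  proof -
    have "(of_int i + \<tau>) / 2 = of_int i / 2 + \<tau> - \<tau> / 2" by (simp add: field_simps)
    then show ?thesis by (simp only: jet_poly_reflect)
  qed
  have "(\<Sum>j | A (i - 2 * j) \<noteq> 0. A (i - 2 * j) *v jet (poly h) (of_int j + \<tau>))
      = (\<Sum>l | A l \<noteq> 0 \<and> even (i - l). A l *v reflected_jet ?p (of_int l / 2))"
  proof (rule sum.reindex_bij_witness[of _ "\<lambda>l. (i - l) div 2" "\<lambda>j. i - 2 * j"])
    fix j
    have "reflected_jet ?p (of_int (i - 2 * j) / 2) = jet (poly h) (of_int j + \<tau>)"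
    proof -
      have "of_int j + \<tau> = of_int i / 2 + \<tau> - of_int (i - 2 * j) / 2" by (simp add: field_simps)
      then show ?thesis by (simp only: jet_poly_reflect)
    qed
    then show "A (i - 2 * j) *v reflected_jet ?p (of_int (i - 2 * j) / 2) = A (i - 2 * j) *v jet (poly h) (of_int j + \<tau>)"
      by (rule arg_cong)
  qed auto
  then show ?thesis unfolding D reproduction_defect_def by auto
qed

text \<open>The rule at level n for p is the rule at level 0 for p(x/2^n), so the single-step
  criterion applies to every level.\<close>

lemma reproduces_poly_iff:
  "reproduces A \<tau> (poly p) \<longleftrightarrow>
    (\<forall>n i. reproduction_defect A \<tau> i (pcompose (pcompose p [:0, 1 / 2 ^ n:]) [:of_int i / 2 + \<tau>, -1:]) = 0)"
proof -
  have step: "jet (poly (pcompose p [:0, 1 / 2 ^ (n + 1):])) x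
      = hermite_D *v jet (poly (pcompose p [:0, 1 / 2 ^ n:])) (x / 2)" for n x
  proof -
    have "hermite_D_pow (n + 1) *v jet (poly p) (x / 2 ^ (n + 1))
        = hermite_D *v (hermite_D_pow n *v jet (poly p) (x / 2 / 2 ^ n))"
      by (simp add: hermite_D_pow_def matrix_vector_mul_assoc)
    then show ?thesis by (simp only: jet_poly_scale)
  qed
  then show ?thesis
    unfolding reproduces_iff hermite_scheme_def scheme_step_iff[symmetric]
    by (simp only: jet_poly_scale step)
qed

lemma reproduces_polynomials_iff:
  "reproduces_polynomials A \<tau> m \<longleftrightarrow> (\<forall>k\<le>m. \<forall>i. reproduction_defect A \<tau> i (q_poly k) = 0)"
proof
  assume rep: "reproduces_polynomials A \<tau> m"
  show "\<forall>k\<le>m. \<forall>i. reproduction_defect A \<tau> i (q_poly k) = 0"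
  proof (intro allI impI)
    fix k i assume "k \<le> m"
    let ?a = "of_int i / 2 + \<tau>"
    \<comment> \<open>The map x -> a - x is an involution, so testing this polynomial at level 0 and
      at the given \<open>i\<close> returns q_k itself.\<close>
    let ?h = "pcompose (q_poly k) [:?a, -1:]"
    have "degree ?h \<le> m"
      using degree_q_poly_le[of k] \<open>k \<le> m\<close> by (simp add: degree_pcompose)
    then have "reproduces A \<tau> (poly ?h)" using rep by (simp add: reproduces_polynomials_def)
    then have "reproduction_defect A \<tau> i (pcompose (pcompose ?h [:0, 1 / 2 ^ 0:]) [:?a, -1:]) = 0"
      unfolding reproduces_poly_iff by blast
    moreover have "pcompose (pcompose ?h [:0, 1 / 2 ^ 0:]) [:?a, -1:] = q_poly k"
      by (simp add: pcompose_pCons flip: pcompose_assoc)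
    ultimately show "reproduction_defect A \<tau> i (q_poly k) = 0" by simp
  qed
next
  assume q: "\<forall>k\<le>m. \<forall>i. reproduction_defect A \<tau> i (q_poly k) = 0"
  \<comment> \<open>Dilation and reflection preserve the degree, so degree at most m is all that has
    to be treated.\<close>
  have "reproduction_defect A \<tau> i p = 0" if "degree p \<le> m" for p i
  proof -
    from that obtain c where "p = (\<Sum>k\<le>m. smult (c k) (q_poly k))" by (rule poly_in_q_basis)
    then show ?thesis using q by (simp add: reproduction_defect_linear)
  qed
  then show "reproduces_polynomials A \<tau> m"
    by (simp add: reproduces_polynomials_def reproduces_poly_iff degree_pcompose)
qed

lemma reproduces_constants_iff: "reproduces_constants A \<tau> \<longleftrightarrow> reproduces_polynomials A \<tau> 0"
proof -
  have "poly [:c:] = (\<lambda>_. c)" for c :: real by auto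
  then show ?thesis
    unfolding reproduces_constants_def reproduces_polynomials_def
    by (metis degree_eq_zeroE degree_pCons_0 le_zero_eq)
qed


section \<open>The two parity conditions in terms of the symbol\<close>

text \<open>The parameter \<zeta> treats both conditions at once: \<open>(- \<zeta>) ^ n\<close> is
  1 at -1 and (-1)^n at 1. After exchanging the sums, the \<alpha>-combinations of q_(k-n)(l/2)
  become the signed derivatives of q_k that form the reflected jet.\<close>

lemma symbol_condition_lhs:
  fixes A :: "'d::{finite,linorder} mask"
  assumes "CARD('d) \<in> {2, 3}" "finite {l. A l \<noteq> 0}" "\<zeta> \<in> {1, -1}"
  shows "mask_symbol_deriv A k \<zeta> *v canonical_vec 1 +
      (\<Sum>s = 2..CARD('d). \<Sum>n = s - 1..k.
        ((- \<zeta>) ^ n * alpha (s - 1) k n) *\<^sub>R (mask_symbol_deriv A (k - n) \<zeta> *v canonical_vec s))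
    = (\<Sum>l | A l \<noteq> 0. \<zeta> powi (l - int k) *\<^sub>R (A l *v reflected_jet (q_poly k) (of_int l / 2)))"
proof -
  define L where "L = {l. A l \<noteq> 0}"
  have \<zeta>: "\<zeta> \<noteq> 0" "(\<zeta> * \<zeta>) ^ n = 1" for n using assms(3) by auto
  have sym: "mask_symbol_deriv A j \<zeta> *v v
      = (\<Sum>l\<in>L. (poly (q_poly j) (of_int l / 2) * \<zeta> powi (l - int j)) *\<^sub>R (A l *v v))" for j v
    unfolding mask_symbol_deriv_eq[OF assms(2) \<zeta>(1)] L_def
    by (induction rule: infinite_finite_induct)
      (simp_all add: matrix_vector_mult_add_rdistrib scaleR_matrix_vector_assoc)
  \<comment> \<open>Since \<zeta>^2 = 1, the sign and the shift of the exponent by n combine to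
    (-1)^n, leaving the common weight \<zeta>^(l-k).\<close>
  have shift: "(- \<zeta>) ^ n * a * (b * \<zeta> powi (l - int (k - n))) = \<zeta> powi (l - int k) * ((-1) ^ n * a * b)"
    if "n \<le> k" for n a b l
  proof -
    have "\<zeta> powi (l - int (k - n)) = \<zeta> powi (l - int k + int n)"
      using that by (simp add: of_nat_diff algebra_simps)
    also have "\<dots> = \<zeta> powi (l - int k) * \<zeta> ^ n"
      using \<zeta>(1) by (simp add: power_int_add)
    moreover have "(- \<zeta>) ^ n * \<zeta> ^ n = (-1) ^ n"
      using \<zeta>(2)[of n] by (simp add: power_minus[of \<zeta>] power_mult_distrib)
    ultimately show ?thesis by (simp add: mult_ac)
  qed
  have inner: "(\<Sum>n = s - 1..k. ((- \<zeta>) ^ n * alpha (s - 1) k n) *\<^sub>R (mask_symbol_deriv A (k - n) \<zeta> *v canonical_vec s))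
      = (\<Sum>l\<in>L. \<zeta> powi (l - int k) *\<^sub>R (A l *v
          (((-1) ^ (s - 1) * poly ((pderiv ^^ (s - 1)) (q_poly k)) (of_int l / 2)) *\<^sub>R canonical_vec s)))"
    if "s \<in> {2..CARD('d)}" for s
  proof -
    have s: "s - 1 \<in> {1, 2}" using that assms(1) by auto
    have "(\<Sum>n = s - 1..k. ((- \<zeta>) ^ n * alpha (s - 1) k n) *\<^sub>R (mask_symbol_deriv A (k - n) \<zeta> *v canonical_vec s))
      = (\<Sum>n = s - 1..k. \<Sum>l\<in>L. (\<zeta> powi (l - int k) *
          ((-1) ^ n * alpha (s - 1) k n * poly (q_poly (k - n)) (of_int l / 2))) *\<^sub>R (A l *v canonical_vec s))"
      by (rule sum.cong) (simp_all only: sym scaleR_sum_right shift scaleR_scaleR atLeastAtMost_iff)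
    also have "\<dots> = (\<Sum>l\<in>L. (\<zeta> powi (l - int k) *
          (\<Sum>n = s - 1..k. (-1) ^ n * alpha (s - 1) k n * poly (q_poly (k - n)) (of_int l / 2))) *\<^sub>R (A l *v canonical_vec s))"
      by (subst sum.swap) (simp add: sum_distrib_left scaleR_sum_left)
    finally show ?thesis
      unfolding sum_alpha_q_poly[OF s] by (simp add: matrix_vector_mult_scaleR)
  qed
  have split: "{1..CARD('d)} = insert 1 {2..CARD('d)}" using assms(1) by auto
  have jet: "A l *v reflected_jet (q_poly k) y = poly (q_poly k) y *\<^sub>R (A l *v canonical_vec 1)
      + (\<Sum>s = 2..CARD('d). A l *v (((-1) ^ (s - 1) * poly ((pderiv ^^ (s - 1)) (q_poly k)) y) *\<^sub>R canonical_vec s))" for l y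
    unfolding reflected_jet_expand split
    by (simp add: matrix_vector_right_distrib linear_sum matrix_vector_mult_scaleR)
  have "(\<Sum>s = 2..CARD('d). \<Sum>n = s - 1..k.
        ((- \<zeta>) ^ n * alpha (s - 1) k n) *\<^sub>R (mask_symbol_deriv A (k - n) \<zeta> *v canonical_vec s))
      = (\<Sum>l\<in>L. \<zeta> powi (l - int k) *\<^sub>R (\<Sum>s = 2..CARD('d). A l *v
          (((-1) ^ (s - 1) * poly ((pderiv ^^ (s - 1)) (q_poly k)) (of_int l / 2)) *\<^sub>R canonical_vec s)))"
    unfolding scaleR_sum_right by (subst sum.swap) (rule sum.cong[OF refl inner])
  then show ?thesis
    by (simp only: sym jet scaleR_add_right sum.distrib L_def[symmetric]) (simp add: mult.commute)
qed

text \<open>The shift gives q_(k,2\<tau>)(-\<tau>/2) = q_k(\<tau>/2). The factors 2, 1, 1/2 are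
  twice the diagonal of D; the sign of the second coordinate sits in \<open>q_tilde\<close>, which
  is minus the first derivative.\<close>

lemma q_vec_eq:
  assumes "CARD('d::{finite,linorder}) \<in> {2, 3}"
  shows "q_vec \<tau> k = 2 *\<^sub>R (hermite_D *v (reflected_jet (q_poly k) (\<tau> / 2) :: (real, 'd) vec))"
proof -
  have x: "- \<tau> / 2 + 2 * \<tau> / 2 = \<tau> / 2" by simp
  have t: "q_tilde k (2 * \<tau>) (- \<tau> / 2) = - poly (pderiv (q_poly k)) (\<tau> / 2)"
    using sum_alpha_q_poly[of 1 k "\<tau> / 2"] unfolding q_tilde_def q_shift_def x by (simp add: alpha_def)
  have h: "q_hat k (2 * \<tau>) (- \<tau> / 2) = poly ((pderiv ^^ 2) (q_poly k)) (\<tau> / 2)"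
    using sum_alpha_q_poly[of 2 k "\<tau> / 2"] unfolding q_hat_def q_shift_def x by (simp add: alpha_def)
  have D: "hermite_D *v v = (\<chi> i. v $ i / 2 ^ (idx i - 1))" for v :: "(real, 'd) vec"
    using hermite_D_pow_mult[of 1 v] by (simp add: hermite_D_pow_def)
  have range: "idx i \<in> {1..CARD('d)}" for i :: 'd
    using bij_betwE[OF idx_bij_betw] by blast
  have idx: "idx i \<in> {1, 2, 3}" for i :: 'd
  proof -
    have "idx i \<ge> 1" "idx i \<le> 3"
      using assms range[of i] by auto
    then show ?thesis by auto
  qed
  have "q_vec \<tau> k $ i = (2 *\<^sub>R (hermite_D *v (reflected_jet (q_poly k) (\<tau> / 2)))) $ i" for i :: 'd
  proof -
    consider "idx i = 1" | "idx i = 2" | "idx i = 3"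
      using idx[of i] by blast
    then show ?thesis
      unfolding q_vec_def t h D reflected_jet_def q_shift_def x
      by cases (simp_all add: numeral_2_eq_2)
  qed
  then show ?thesis by (simp add: vec_eq_iff)
qed

text \<open>The even and the odd i give one equation each, E = r and U = r. Together they say E = U
  and E + U = 2r; the weights (-1)^(l-k) produce E - U up to sign, and the weights 1 produce E +
  U.\<close>

lemma defect_iff_symbol_condition:
  fixes A :: "'d::{finite,linorder} mask"
  assumes "CARD('d) \<in> {2, 3}" "finite {l. A l \<noteq> 0}"
  shows "(\<forall>i. reproduction_defect A \<tau> i (q_poly k) = 0) \<longleftrightarrow>
      (\<Sum>l | A l \<noteq> 0. (-1) powi (l - int k) *\<^sub>R (A l *v reflected_jet (q_poly k) (of_int l / 2))) = 0 \<and>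
      (\<Sum>l | A l \<noteq> 0. 1 powi (l - int k) *\<^sub>R (A l *v reflected_jet (q_poly k) (of_int l / 2))) = q_vec \<tau> k"
proof -
  define g where "g l = A l *v reflected_jet (q_poly k) (of_int l / 2)" for l
  define E where "E = (\<Sum>l | A l \<noteq> 0 \<and> even l. g l)"
  define U where "U = (\<Sum>l | A l \<noteq> 0 \<and> odd l. g l)"
  define r where "r = hermite_D *v (reflected_jet (q_poly k) (\<tau> / 2) :: (real, 'd) vec)"
  have split: "(\<Sum>l | A l \<noteq> 0. f l) = (\<Sum>l | A l \<noteq> 0 \<and> even l. f l) + (\<Sum>l | A l \<noteq> 0 \<and> odd l. f l)"
    for f :: "int \<Rightarrow> (real, 'd) vec"
  proof -
    have "{l. A l \<noteq> 0} = {l. A l \<noteq> 0 \<and> even l} \<union> {l. A l \<noteq> 0 \<and> odd l}" by auto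
    moreover have "(\<Sum>l\<in>{l. A l \<noteq> 0 \<and> even l} \<union> {l. A l \<noteq> 0 \<and> odd l}. f l)
        = (\<Sum>l | A l \<noteq> 0 \<and> even l. f l) + (\<Sum>l | A l \<noteq> 0 \<and> odd l. f l)"
      by (rule sum.union_disjoint) (auto intro: finite_subset[OF _ assms(2)])
    ultimately show ?thesis by (simp only:)
  qed
  have defect: "reproduction_defect A \<tau> i (q_poly k) = (if even i then E else U) - r" for i
    by (auto simp: reproduction_defect_def E_def U_def r_def g_def)
  have plus: "(\<Sum>l | A l \<noteq> 0. 1 powi (l - int k) *\<^sub>R g l) = E + U"
    by (simp add: split[of g] E_def U_def)
  have "(\<Sum>l | A l \<noteq> 0. (-1) powi (l - int k) *\<^sub>R g l)
      = (\<Sum>l | A l \<noteq> 0 \<and> even l. (-1) ^ k *\<^sub>R g l) + (\<Sum>l | A l \<noteq> 0 \<and> odd l. - ((-1) ^ k *\<^sub>R g l))"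
    unfolding split
    by (intro arg_cong2[where f = "(+)"] sum.cong) (auto simp: power_int_minus_left minus_one_power_iff)
  also have "\<dots> = (-1) ^ k *\<^sub>R (E - U)"
    by (simp add: E_def U_def scaleR_right_diff_distrib scaleR_sum_right sum_negf)
  finally have "(\<Sum>l | A l \<noteq> 0. (-1) powi (l - int k) *\<^sub>R g l) = (-1) ^ k *\<^sub>R (E - U)" .
  then have minus: "(\<Sum>l | A l \<noteq> 0. (-1) powi (l - int k) *\<^sub>R g l) = 0 \<longleftrightarrow> E = U" by simp
  have "(\<forall>i. reproduction_defect A \<tau> i (q_poly k) = 0) \<longleftrightarrow> E = r \<and> U = r"
    unfolding defect by (auto split: if_splits dest: spec[of _ "0 :: int"] spec[of _ "1 :: int"])
  also have "\<dots> \<longleftrightarrow> E = U \<and> E + U = 2 *\<^sub>R r"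
    by (metis scaleR_2 scaleR_cancel_left zero_neq_numeral)
  finally show ?thesis
    unfolding g_def[symmetric] minus plus by (simp add: q_vec_eq[OF assms(1)] r_def)
qed

lemma defect_iff:
  fixes A :: "'d::{finite,linorder} mask"
  assumes "CARD('d) \<in> {2, 3}" "finite {l. A l \<noteq> 0}"
  shows "(\<forall>i. reproduction_defect A \<tau> i (q_poly k) = 0) \<longleftrightarrow>
    mask_symbol_deriv A k (-1) *v canonical_vec 1 +
      (\<Sum>s = 2..CARD('d). \<Sum>l = s - 1..k.
        alpha (s - 1) k l *\<^sub>R (mask_symbol_deriv A (k - l) (-1) *v canonical_vec s)) = 0 \<and>
    mask_symbol_deriv A k 1 *v canonical_vec 1 +
      (\<Sum>s = 2..CARD('d). \<Sum>l = s - 1..k.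
        ((-1) ^ l * alpha (s - 1) k l) *\<^sub>R (mask_symbol_deriv A (k - l) 1 *v canonical_vec s)) = q_vec \<tau> k"
  unfolding defect_iff_symbol_condition[OF assms]
  using symbol_condition_lhs[OF assms, of "-1" k] symbol_condition_lhs[OF assms, of 1 k] by simp


theorem theorem18:
  fixes A :: "'d::{finite,linorder} mask" and \<tau> :: real
  assumes "CARD('d) \<in> {2, 3}"
    and "finite {l. A l \<noteq> 0}"
  shows "(reproduces_constants A \<tau> \<longleftrightarrow>
            mask_symbol A (-1) *v canonical_vec 1 = 0 \<and>
            mask_symbol A 1 *v canonical_vec 1 = 2 *\<^sub>R canonical_vec 1) \<and>
         (\<forall>m\<ge>1. reproduces_polynomials A \<tau> m \<longleftrightarrow>
            reproduces_constants A \<tau> \<and>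
            (\<forall>k\<in>{1..m}.
               mask_symbol_deriv A k (-1) *v canonical_vec 1 +
                 (\<Sum>s = 2..CARD('d). \<Sum>l = s - 1..k.
                    alpha (s - 1) k l *\<^sub>R (mask_symbol_deriv A (k - l) (-1) *v canonical_vec s)) = 0 \<and>
               mask_symbol_deriv A k 1 *v canonical_vec 1 +
                 (\<Sum>s = 2..CARD('d). \<Sum>l = s - 1..k.
                    ((-1) ^ l * alpha (s - 1) k l) *\<^sub>R
                      (mask_symbol_deriv A (k - l) 1 *v canonical_vec s)) = q_vec \<tau> k))"
proof -
  let ?C = "\<lambda>k. mask_symbol_deriv A k (-1) *v canonical_vec 1 +
      (\<Sum>s = 2..CARD('d). \<Sum>l = s - 1..k.
        alpha (s - 1) k l *\<^sub>R (mask_symbol_deriv A (k - l) (-1) *v canonical_vec s)) = 0 \<and>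
    mask_symbol_deriv A k 1 *v canonical_vec 1 +
      (\<Sum>s = 2..CARD('d). \<Sum>l = s - 1..k.
        ((-1) ^ l * alpha (s - 1) k l) *\<^sub>R (mask_symbol_deriv A (k - l) 1 *v canonical_vec s)) = q_vec \<tau> k"
  have poly: "reproduces_polynomials A \<tau> m \<longleftrightarrow> (\<forall>k\<le>m. ?C k)" for m
    unfolding reproduces_polynomials_iff defect_iff[OF assms] ..
  have const: "reproduces_constants A \<tau> \<longleftrightarrow> ?C 0"
    unfolding reproduces_constants_iff poly by simp
  \<comment> \<open>For k = 0 the inner range starts at s - 1 \<ge> 1 and is empty, so the general
    condition becomes the one for constants.\<close>
  have empty: "(\<Sum>s = 2..CARD('d). \<Sum>l = s - 1..0. f s l) = 0" for f :: "nat \<Rightarrow> nat \<Rightarrow> (real, 'd) vec"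
    by (intro sum.neutral) simp
  have rhs: "q_vec \<tau> 0 = (2 *\<^sub>R canonical_vec 1 :: (real, 'd) vec)"
    by (simp add: q_vec_def canonical_vec_def vec_eq_iff q_shift_def q_poly_def q_tilde_def q_hat_def)
  have zero: "?C 0 \<longleftrightarrow> mask_symbol A (-1) *v canonical_vec 1 = 0 \<and>
      mask_symbol A 1 *v canonical_vec 1 = 2 *\<^sub>R canonical_vec 1"
    unfolding empty rhs by (simp add: mask_symbol_deriv_def)
  have "(\<forall>k\<le>m. ?C k) \<longleftrightarrow> ?C 0 \<and> (\<forall>k\<in>{1..m}. ?C k)" for m
  proof -
    have "{..m} = insert 0 {1..m}" by auto
    then have "(\<forall>k\<in>{..m}. ?C k) \<longleftrightarrow> (\<forall>k\<in>insert 0 {1..m}. ?C k)" by (rule arg_cong)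
    then show ?thesis by (simp only: ball_simps Ball_def[of "{..m}"] atMost_iff)
  qed
  then show ?thesis
    unfolding poly const by (intro conjI allI impI) (rule zero, assumption)
qed

end
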